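(* $\mathcal T_0\subseteq\mathcal S\subseteq\mathcal T$, where $\mathcal T_0$ is the class of trigraph trees, $\mathcal S$ the class of special tree-like trigraphs, and $\mathcal T$ the class of tree-like trigraphs.
   Context: A trigraph $H$ has a finite vertex set $V(H)$ and disjoint sets $W(H)$ (weak edges) and $S(H)$ (strong edges) of ordered pairs of vertices (loops allowed); an edge is an element of $W(H)\cup S(H)$. Adjacency, components and bridges refer to the underlying graph (distinct $x,y$ adjacent iff $xy$ or $yx$ is an edge). An edge $xy$ is symmetric, and $y$ a symmetric neighbour of $x$, if both $xy,yx$ are edges. $H\setminus F$ is $H$ minus the edge set $F$; $H-x$ is $H$ minus vertex $x$. A trigraph tree is a trigraph whose underlying graph is a tree. Weak domination: $y$ weakly dominates $x$ on $D\subseteq V(H)$ if for every $z\in D$, $zy\in W(H)$ whenever $zx\in W(H)$ and $yz\in W(H)$ whenever $xz\in W(H)$; "$y$ weakly dominates $x$" means on $D=V(H)$. A domination ordering is $x_1,\dots,x_t$ with $x_i$ weakly dominating $x_j$ whenever $i<j$. Domination property: for $x$ with a strong loop and a component $K$ of $H-x$, let $R_K$ be the symmetric neighbours of $x$ in $K$; $K$ satisfies the domination property if (D1) no vertex of $R_K$ has a strong loop, and (D2) the vertices of $R_K$ with weak loops admit a domination ordering, each weakly dominates $x$ on $V(K)$, and each weakly dominates every vertex of $R_K$ without a loop. Matching property: a set $F$ of edges separates $H$ if each $xy\in F$ has $x,y$ in different components of $H\setminus F$. Let $F^*=\{xy\in F:$ neither $xy$ nor $yx$ is strong$\}$. $F$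 satisfies the matching property if (M1) $F$ separates $H$; (M2) for any $xy\in F^*$, $xx$ and $yy$ are strong loops; (M3) if $xy,zy\in F$ and neither is a bridge of $H$, then $xz$ is not symmetric and $xx$ or $zz$ is a strong loop; (M4) if $xy,xz\in F$ and neither is a bridge, then $yz$ is not symmetric and $yy$ or $zz$ is a strong loop; (M5) if $xy\in F^*$ and $xz,yw$ are symmetric edges with $xz\notin F$, then $zw\notin F^*$ and $xw\notin F^*$; (M6) if $xy\in F^*$ and $xz,yw$ are symmetric edges with $yw\notin F$, then $zw\notin F^*$ and $zy\notin F^*$. Class $\mathcal T$ (tree-like trigraphs), defined recursively: (T1) if $H$ has no strong edges or loops then $H\in\mathcal T$; (T2) if $H$ has a strong loop at $x$ with $H-x\in\mathcal T$ and every component of $H-x$ satisfying the domination property, then $H\in\mathcal T$; (T3) if $H$ has an edge set $F$ with $H\setminus F\in\mathcal T$ and $F$ satisfying the matching property, then $H\in\mathcal T$. Class $\mathcal S$ (special tree-like trigraphs): let $F(H)$ be the set of edges $xy$ of $H$ such that either $xy$ or $yx$ is a strong edge, or $xy$ and $yx$ are weak edges and $x$ and $y$ both have strong loops. $H\in\mathcal S$ if there is a set $F'\supseteq F(H)$ of edges of $H$ such that (S1) $F'$ satisfies the matching property (in $H$), and (S2) for every strong loop $x$ of $H\setminus F'$, each component $K$ of $(H\setminus F')-x$ satisfies the domination property in $H\setminus F'$.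
   Formalization: Loops do not count as edges in F(H) or as symmetric edges (else a single vertex with a strong loop is a tree outside S); in (M3) and (M4) the two edges are distinct; (T1) excludes strong edges and strong loops but allows weak loops. *)

theory Defs
  imports Main
begin

section \<open>Trigraphs\<close>

record 'a trigraph =
  verts :: "'a set"
  weak :: "('a \<times> 'a) set"
  strong :: "('a \<times> 'a) set"

definition trigraph :: "'a trigraph \<Rightarrow> bool" where
  "trigraph H \<longleftrightarrow>
     finite (verts H) \<and>
     weak H \<subseteq> verts H \<times> verts H \<and>
     strong H \<subseteq> verts H \<times> verts H \<and>
     weak H \<inter> strong H = {}"

definition edges :: "'a trigraph \<Rightarrow> ('a \<times> 'a) set" where
  "edges H = weak H \<union> strong H"

definition delete_edges :: "'a trigraph \<Rightarrow> ('a \<times> 'a) set \<Rightarrow> 'a trigraph" where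
  "delete_edges H F = \<lparr>verts = verts H, weak = weak H - F, strong = strong H - F\<rparr>"

definition delete_vertex :: "'a trigraph \<Rightarrow> 'a \<Rightarrow> 'a trigraph" where
  "delete_vertex H x =
     (let V = verts H - {x} in
      \<lparr>verts = V, weak = weak H \<inter> V \<times> V, strong = strong H \<inter> V \<times> V\<rparr>)"

section \<open>The underlying graph\<close>

definition adjacent :: "'a trigraph \<Rightarrow> 'a \<Rightarrow> 'a \<Rightarrow> bool" where
  "adjacent H x y \<longleftrightarrow> x \<noteq> y \<and> ((x, y) \<in> edges H \<or> (y, x) \<in> edges H)"

text \<open>Components are represented by their vertex sets.\<close>

definition component_of :: "'a trigraph \<Rightarrow> 'a \<Rightarrow> 'a set" where
  "component_of H x = {y \<in> verts H. (adjacent H)\<^sup>*\<^sup>* x y}"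

definition components :: "'a trigraph \<Rightarrow> 'a set set" where
  "components H = component_of H ` verts H"

text \<open>An edge of the underlying graph may come from two ordered pairs; both are deleted.\<close>

definition bridge :: "'a trigraph \<Rightarrow> 'a \<Rightarrow> 'a \<Rightarrow> bool" where
  "bridge H x y \<longleftrightarrow>
     adjacent H x y \<and>
     component_of (delete_edges H {(x, y), (y, x)}) x \<noteq>
     component_of (delete_edges H {(x, y), (y, x)}) y"

definition cycle :: "'a trigraph \<Rightarrow> 'a list \<Rightarrow> bool" where
  "cycle H vs \<longleftrightarrow>
     3 \<le> length vs \<and> distinct vs \<and> set vs \<subseteq> verts H \<and>
     (\<forall>i < length vs. adjacent H (vs ! i) (vs ! (Suc i mod length vs)))"

definition trigraph_trees :: "'a trigraph set" where
  "trigraph_trees =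
     {H. trigraph H \<and> verts H \<noteq> {} \<and>
         (\<forall>x \<in> verts H. \<forall>y \<in> verts H. (adjacent H)\<^sup>*\<^sup>* x y) \<and>
         \<not> (\<exists>vs. cycle H vs)}"

text \<open>
  A symmetric edge joins two distinct vertices. If a loop \<open>xx\<close> counted as a symmetric edge,
  then a tree consisting of one symmetric weak edge between two strong loops would violate the
  fifth clause of the matching property below (take \<open>z = x\<close> and \<open>w = y\<close>).
\<close>

definition symmetric_edge :: "'a trigraph \<Rightarrow> 'a \<Rightarrow> 'a \<Rightarrow> bool" where
  "symmetric_edge H x y \<longleftrightarrow> x \<noteq> y \<and> (x, y) \<in> edges H \<and> (y, x) \<in> edges H"

section \<open>Weak domination\<close>

definition weakly_dominates_on :: "'a trigraph \<Rightarrow> 'a set \<Rightarrow> 'a \<Rightarrow> 'a \<Rightarrow> bool" where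
  "weakly_dominates_on H D y x \<longleftrightarrow>
     (\<forall>z \<in> D. ((z, x) \<in> weak H \<longrightarrow> (z, y) \<in> weak H) \<and>
              ((x, z) \<in> weak H \<longrightarrow> (y, z) \<in> weak H))"

abbreviation weakly_dominates :: "'a trigraph \<Rightarrow> 'a \<Rightarrow> 'a \<Rightarrow> bool" where
  "weakly_dominates H \<equiv> weakly_dominates_on H (verts H)"

definition domination_ordering :: "'a trigraph \<Rightarrow> 'a list \<Rightarrow> bool" where
  "domination_ordering H xs \<longleftrightarrow> sorted_wrt (weakly_dominates H) xs"

definition domination_property :: "'a trigraph \<Rightarrow> 'a \<Rightarrow> 'a set \<Rightarrow> bool" where
  "domination_property H x K \<longleftrightarrow>
     (let R = {y \<in> K. symmetric_edge H x y};
          RW = {y \<in> R. (y, y) \<in> weak H}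
      in (\<forall>y \<in> R. (y, y) \<notin> strong H) \<and>
         (\<exists>xs. distinct xs \<and> set xs = RW \<and> domination_ordering H xs) \<and>
         (\<forall>y \<in> RW. weakly_dominates_on H K y x) \<and>
         (\<forall>y \<in> RW. \<forall>z \<in> R. (z, z) \<notin> edges H \<longrightarrow> weakly_dominates H y z))"

section \<open>The matching property\<close>

definition separates :: "'a trigraph \<Rightarrow> ('a \<times> 'a) set \<Rightarrow> bool" where
  "separates H F \<longleftrightarrow>
     (\<forall>(x, y) \<in> F. component_of (delete_edges H F) x \<noteq> component_of (delete_edges H F) y)"

definition nonstrong_part :: "'a trigraph \<Rightarrow> ('a \<times> 'a) set \<Rightarrow> ('a \<times> 'a) set" where
  "nonstrong_part H F = {(x, y) \<in> F. (x, y) \<notin> strong H \<and> (y, x) \<notin> strong H}"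

text \<open>
  The third and fourth clauses concern two different edges with a common end, hence the
  assumptions \<open>x \<noteq> z\<close> and \<open>y \<noteq> z\<close>.
\<close>

definition matching_property :: "'a trigraph \<Rightarrow> ('a \<times> 'a) set \<Rightarrow> bool" where
  "matching_property H F \<longleftrightarrow>
     F \<subseteq> edges H \<and>
     separates H F \<and>
     (\<forall>x y. (x, y) \<in> nonstrong_part H F \<longrightarrow> (x, x) \<in> strong H \<and> (y, y) \<in> strong H) \<and>
     (\<forall>x y z. x \<noteq> z \<and> (x, y) \<in> F \<and> (z, y) \<in> F \<and> \<not> bridge H x y \<and> \<not> bridge H z y \<longrightarrow>
        \<not> symmetric_edge H x z \<and> ((x, x) \<in> strong H \<or> (z, z) \<in> strong H)) \<and>
     (\<forall>x y z. y \<noteq> z \<and> (x, y) \<in> F \<and> (x, z) \<in> F \<and> \<not> bridge H x y \<and> \<not> bridge H x z \<longrightarrow>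
        \<not> symmetric_edge H y z \<and> ((y, y) \<in> strong H \<or> (z, z) \<in> strong H)) \<and>
     (\<forall>x y z w. (x, y) \<in> nonstrong_part H F \<and> symmetric_edge H x z \<and> symmetric_edge H y w \<and>
        (x, z) \<notin> F \<longrightarrow>
        (z, w) \<notin> nonstrong_part H F \<and> (x, w) \<notin> nonstrong_part H F) \<and>
     (\<forall>x y z w. (x, y) \<in> nonstrong_part H F \<and> symmetric_edge H x z \<and> symmetric_edge H y w \<and>
        (y, w) \<notin> F \<longrightarrow>
        (z, w) \<notin> nonstrong_part H F \<and> (z, y) \<notin> nonstrong_part H F)"

section \<open>Tree-like and special tree-like trigraphs\<close>

text \<open>
  In the base case weak loops are allowed: what is excluded is strong edges and strong loops.
\<close>

inductive_set tree_like_trigraphs :: "'a trigraph set" where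
  no_strong: "trigraph H \<Longrightarrow> strong H = {} \<Longrightarrow> H \<in> tree_like_trigraphs"
| delete_strong_loop:
    "trigraph H \<Longrightarrow> (x, x) \<in> strong H \<Longrightarrow> delete_vertex H x \<in> tree_like_trigraphs \<Longrightarrow>
     (\<And>K. K \<in> components (delete_vertex H x) \<Longrightarrow> domination_property H x K) \<Longrightarrow>
     H \<in> tree_like_trigraphs"
| delete_matching:
    "trigraph H \<Longrightarrow> F \<subseteq> edges H \<Longrightarrow> delete_edges H F \<in> tree_like_trigraphs \<Longrightarrow>
     matching_property H F \<Longrightarrow>
     H \<in> tree_like_trigraphs"

text \<open>
  Loops are left out of \<open>forced_edges\<close>, since no set of edges that separates the trigraph
  contains a loop.
\<close>

definition forced_edges :: "'a trigraph \<Rightarrow> ('a \<times> 'a) set" where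
  "forced_edges H =
     {(x, y) \<in> edges H. x \<noteq> y \<and>
        ((x, y) \<in> strong H \<or> (y, x) \<in> strong H \<or>
         ((x, y) \<in> weak H \<and> (y, x) \<in> weak H \<and> (x, x) \<in> strong H \<and> (y, y) \<in> strong H))}"

definition special_trigraphs :: "'a trigraph set" where
  "special_trigraphs =
     {H. trigraph H \<and>
         (\<exists>F. forced_edges H \<subseteq> F \<and> F \<subseteq> edges H \<and> matching_property H F \<and>
              (\<forall>x. (x, x) \<in> strong (delete_edges H F) \<longrightarrow>
                (\<forall>K \<in> components (delete_vertex (delete_edges H F) x).
                   domination_property (delete_edges H F) x K)))}"

end

theory Submission
  imports Defs
begin

text \<open>
  In a tree every edge between distinct vertices is a bridge, so the forced edges themselves serve as
  the separating set: a violation of the last two clauses of the matching property would yield a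
  triangle or a 4-cycle, and \<open>x\<close> has at most one neighbour in each component of the trigraph minus
  \<open>x\<close>, which trivializes the domination property. Conversely, once all strong edges are loops, the
  domination property is inherited when a vertex is deleted, so the strong loops of a special
  trigraph can be removed one by one.
\<close>

section \<open>Paths, adjacency and deletion\<close>

text \<open>The path is built from its far end. If the new first vertex already occurs, the path is
  cut back to that occurrence, which keeps it free of repetitions.\<close>

lemma rtranclp_imp_distinct_path:
  assumes "r\<^sup>*\<^sup>* a b"
  shows "\<exists>vs. vs \<noteq> [] \<and> hd vs = a \<and> last vs = b \<and> distinct vs \<and> successively r vs"
  using assms
proof (induction rule: converse_rtranclp_induct)
  case base
  show ?case by (intro exI[of _ "[b]"]) auto
next
  case (step a c)
  then obtain vs where vs: "vs \<noteq> []" "hd vs = c" "last vs = b" "distinct vs" "successively r vs"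
    by blast
  show ?case
  proof (cases "a \<in> set vs")
    case True
    then obtain us ws where "vs = us @ a # ws" by (meson split_list)
    with vs show ?thesis
      by (intro exI[of _ "a # ws"]) (auto simp: successively_append_iff)
  next
    case False
    with vs step show ?thesis
      by (intro exI[of _ "a # vs"]) (auto simp: successively_Cons)
  qed
qed

lemma adjacent_sym: "adjacent H x y \<Longrightarrow> adjacent H y x"
  by (auto simp: adjacent_def)

lemma adjacent_verts: "trigraph H \<Longrightarrow> adjacent H x y \<Longrightarrow> x \<in> verts H \<and> y \<in> verts H"
  by (auto simp: adjacent_def edges_def trigraph_def)

lemma adjacent_delete_edges: "adjacent (delete_edges H F) x y \<Longrightarrow> adjacent H x y"
  by (auto simp: adjacent_def edges_def delete_edges_def)

lemma adjacent_delete_vertex: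
  "adjacent (delete_vertex H v) x y \<longleftrightarrow> adjacent H x y \<and> x \<noteq> v \<and> y \<noteq> v" if "trigraph H"
  using that by (auto simp: adjacent_def edges_def delete_vertex_def Let_def trigraph_def)

lemma trigraph_delete_edges: "trigraph H \<Longrightarrow> trigraph (delete_edges H F)"
  by (auto simp: trigraph_def delete_edges_def)

lemma trigraph_delete_vertex: "trigraph H \<Longrightarrow> trigraph (delete_vertex H x)"
  by (auto simp: trigraph_def delete_vertex_def Let_def)

section \<open>Cycles, bridges and neighbours in acyclic trigraphs\<close>

text \<open>Replaces the modular indices of \<open>cycle\<close> by a path and one closing
  adjacency, which covers the wrap-around index.\<close>

lemma cycleI:
  assumes "trigraph H" "3 \<le> length vs" "distinct vs" "successively (adjacent H) vs"
    "adjacent H (last vs) (hd vs)"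
  shows "cycle H vs"
proof -
  have adj: "adjacent H (vs ! i) (vs ! (Suc i mod length vs))" if "i < length vs" for i
  proof (cases "Suc i < length vs")
    case True
    with assms(4) show ?thesis by (simp add: successively_conv_nth)
  next
    case False
    with that have i: "i = length vs - 1" "Suc i = length vs" and "vs \<noteq> []" by auto
    then show ?thesis
      using assms(5) by (simp only: i(2) mod_self) (simp add: i(1) last_conv_nth hd_conv_nth)
  qed
  moreover have "set vs \<subseteq> verts H"
    using adj adjacent_verts[OF assms(1)] by (metis in_set_conv_nth subsetI)
  ultimately show ?thesis
    using assms by (auto simp: cycle_def)
qed

text \<open>A path from \<open>x\<close> to \<open>y\<close> that survives the deletion would close
  up to a cycle through the edge between \<open>y\<close> and \<open>x\<close>. Leaving
  \<open>F\<close> arbitrary serves both bridges and separating sets.\<close>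

lemma acyclic_not_reachable_without_edge:
  assumes "trigraph H" "\<nexists>vs. cycle H vs" "adjacent H x y" "(x, y) \<in> F" "(y, x) \<in> F"
  shows "\<not> (adjacent (delete_edges H F))\<^sup>*\<^sup>* x y"
proof
  assume "(adjacent (delete_edges H F))\<^sup>*\<^sup>* x y"
  then obtain vs where vs: "vs \<noteq> []" "hd vs = x" "last vs = y" "distinct vs"
    and path: "successively (adjacent (delete_edges H F)) vs"
    using rtranclp_imp_distinct_path by metis
  have "x \<noteq> y" using assms(3) by (simp add: adjacent_def)
  have "\<not> adjacent (delete_edges H F) x y"
    using assms(4,5) by (auto simp: adjacent_def edges_def delete_edges_def)
  \<comment> \<open>A single vertex would force \<open>x = y\<close>, and a path on two vertices
    would use the deleted edge.\<close>
  then have "3 \<le> length vs"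
    using vs path \<open>x \<noteq> y\<close>
    by (cases vs rule: remdups_adj.cases) (auto simp: Suc_le_eq split: if_splits)
  moreover have "successively (adjacent H) vs"
    using path by (rule successively_mono) (auto dest: adjacent_delete_edges)
  ultimately have "cycle H vs"
    using vs assms(1,3) by (intro cycleI) (auto intro: adjacent_sym)
  with assms(2) show False by blast
qed

lemma acyclic_separated_ends:
  assumes "trigraph H" "\<nexists>vs. cycle H vs" "adjacent H x y" "(x, y) \<in> F" "(y, x) \<in> F"
  shows "component_of (delete_edges H F) x \<noteq> component_of (delete_edges H F) y"
proof -
  have "y \<in> component_of (delete_edges H F) y"
    using adjacent_verts[OF assms(1,3)] by (simp add: component_of_def delete_edges_def)
  moreover have "y \<notin> component_of (delete_edges H F) x"
    using acyclic_not_reachable_without_edge[OF assms] by (simp add: component_of_def)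
  ultimately show ?thesis by blast
qed

lemma acyclic_bridge:
  "trigraph H \<Longrightarrow> \<nexists>vs. cycle H vs \<Longrightarrow> adjacent H x y \<Longrightarrow> bridge H x y"
  using acyclic_separated_ends[of H x y "{(x, y), (y, x)}"] by (simp add: bridge_def)

text \<open>Prepending \<open>x\<close> to a path between two of its neighbours that avoids
  \<open>x\<close> gives a cycle. Hence \<open>x\<close> has at most one neighbour in each component
  of the trigraph minus \<open>x\<close>.\<close>

lemma acyclic_unique_neighbour:
  assumes "trigraph H" "\<nexists>vs. cycle H vs" "adjacent H x y" "adjacent H x z"
    and "(adjacent (delete_vertex H x))\<^sup>*\<^sup>* y z"
  shows "y = z"
proof (rule ccontr)
  assume "y \<noteq> z"
  obtain vs where vs: "vs \<noteq> []" "hd vs = y" "last vs = z" "distinct vs"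
    and path: "successively (adjacent (delete_vertex H x)) vs"
    using rtranclp_imp_distinct_path[OF assms(5)] by metis
  from path have path_H: "successively (\<lambda>u v. adjacent H u v \<and> u \<noteq> x \<and> v \<noteq> x) vs"
    by (simp add: adjacent_delete_vertex[OF assms(1)])
  \<comment> \<open>Each step of the path avoids \<open>x\<close> at both ends; a path without steps
    is covered by \<open>y \<noteq> x\<close>.\<close>
  have "x \<notin> set vs"
  proof -
    have "y \<noteq> x" using assms(3) by (auto simp: adjacent_def)
    with vs(1,2) path_H show ?thesis
      by (induction vs arbitrary: y rule: induct_list012) auto
  qed
  moreover have "2 \<le> length vs"
    using vs \<open>y \<noteq> z\<close> by (cases vs rule: remdups_adj.cases) auto
  moreover have "successively (adjacent H) vs"
    using path_H by (rule successively_mono) auto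
  ultimately have "cycle H (x # vs)"
    using vs assms by (intro cycleI) (auto simp: successively_Cons intro: adjacent_sym)
  with assms(2) show False by blast
qed

lemma no_triangle:
  assumes "trigraph H" "\<nexists>vs. cycle H vs" "adjacent H a b" "adjacent H b c" "adjacent H c a"
  shows False
proof -
  have "cycle H [a, b, c]"
    using assms by (intro cycleI) (auto simp: adjacent_def)
  with assms(2) show False by blast
qed

text \<open>Adjacency already separates consecutive corners, so only opposite corners have to be
  assumed distinct.\<close>

lemma no_quadrangle:
  assumes "trigraph H" "\<nexists>vs. cycle H vs"
    "adjacent H a b" "adjacent H b c" "adjacent H c d" "adjacent H d a" "a \<noteq> c" "b \<noteq> d"
  shows False
proof -
  have "cycle H [a, b, c, d]"
    using assms by (intro cycleI) (auto simp: adjacent_def)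
  with assms(2) show False by blast
qed

section \<open>Trees are special: the forced edges as separating set\<close>

lemma forced_edges_sym: "(x, y) \<in> forced_edges H \<Longrightarrow> (y, x) \<in> edges H \<Longrightarrow> (y, x) \<in> forced_edges H"
  by (auto simp: forced_edges_def)

lemma forced_edges_adjacent: "(x, y) \<in> forced_edges H \<Longrightarrow> adjacent H x y"
  by (auto simp: forced_edges_def adjacent_def)

lemma symmetric_edge_adjacent: "symmetric_edge H x y \<Longrightarrow> adjacent H x y"
  by (auto simp: symmetric_edge_def adjacent_def)

text \<open>Separation comes from acyclicity, and the strong loops at nonstrong forced edges from
  the definition. The two clauses on edges with a common end hold vacuously, since all forced edges
  are bridges. The last two clauses reduce to excluded triangles and quadrangles.\<close>

lemma acyclic_matching_property_forced_edges:
  assumes H: "trigraph H" and ac: "\<nexists>vs. cycle H vs"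
  shows "matching_property H (forced_edges H)"
proof -
  let ?F = "forced_edges H"
  have sep: "separates H ?F"
    unfolding separates_def
  proof clarify
    fix x y
    assume xy: "(x, y) \<in> ?F"
      and eq: "component_of (delete_edges H ?F) x = component_of (delete_edges H ?F) y"
    \<comment> \<open>The separation lemma wants both orientations deleted. The reverse pair is
      either no edge or already forced, so adding it changes nothing.\<close>
    have "delete_edges H ({(y, x)} \<union> ?F) = delete_edges H ?F"
      using forced_edges_sym[OF xy] by (auto simp: delete_edges_def edges_def)
    with eq acyclic_separated_ends[OF H ac forced_edges_adjacent[OF xy], of "{(y, x)} \<union> ?F"] xy
    show False by simp
  qed
  have adj_sym: "adjacent H x y" "adjacent H y x" if "(x, y) \<in> nonstrong_part H ?F" for x y
    using that by (auto simp: nonstrong_part_def dest: forced_edges_adjacent intro: adjacent_sym)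
  \<comment> \<open>Such an edge would complete the quadrangle \<open>x\<close>, \<open>y\<close>,
    \<open>w\<close>, \<open>z\<close>.\<close>
  have no_shortcut: "(z, w) \<notin> nonstrong_part H ?F"
    if "(x, y) \<in> nonstrong_part H ?F" "symmetric_edge H x z" "symmetric_edge H y w"
      "z \<noteq> y" "w \<noteq> x" for x y z w
    using no_quadrangle[OF H ac, of x y w z] that
    by (metis adj_sym adjacent_sym symmetric_edge_adjacent)
  have "(z, w) \<notin> nonstrong_part H ?F \<and> (x, w) \<notin> nonstrong_part H ?F"
    if xy: "(x, y) \<in> nonstrong_part H ?F" and xz: "symmetric_edge H x z"
      and yw: "symmetric_edge H y w" and "(x, z) \<notin> ?F" for x y z w
  proof
    have "z \<noteq> y" using that by (auto simp: nonstrong_part_def)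
    \<comment> \<open>This settles the degenerate case \<open>w = x\<close>, where
      \<open>no_shortcut\<close> does not apply.\<close>
    moreover have "(z, x) \<notin> ?F"
      using that forced_edges_sym by (fastforce simp: symmetric_edge_def)
    ultimately show "(z, w) \<notin> nonstrong_part H ?F"
      using no_shortcut[OF xy xz yw] by (auto simp: nonstrong_part_def)
    show "(x, w) \<notin> nonstrong_part H ?F"
      using no_triangle[OF H ac, of x y w] xy yw
      by (meson adj_sym symmetric_edge_adjacent)
  qed
  moreover have "(z, w) \<notin> nonstrong_part H ?F \<and> (z, y) \<notin> nonstrong_part H ?F"
    if xy: "(x, y) \<in> nonstrong_part H ?F" and xz: "symmetric_edge H x z"
      and yw: "symmetric_edge H y w" and "(y, w) \<notin> ?F" for x y z w
  proof
    \<comment> \<open>A forced edge that is strong in neither direction is weak in both, so its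
      reverse is forced too; this separates \<open>w\<close> from \<open>x\<close>.\<close>
    have "(y, x) \<in> ?F"
      using xy by (auto simp: nonstrong_part_def forced_edges_def edges_def)
    then have "w \<noteq> x" using that by auto
    moreover have "(y, w) \<notin> ?F" by fact
    ultimately show "(z, w) \<notin> nonstrong_part H ?F"
      using no_shortcut[OF xy xz yw] by (auto simp: nonstrong_part_def)
    show "(z, y) \<notin> nonstrong_part H ?F"
      using no_triangle[OF H ac, of x y z] xy xz
      by (meson adj_sym adjacent_sym symmetric_edge_adjacent)
  qed
  moreover have "?F \<subseteq> edges H"
    by (auto simp: forced_edges_def)
  moreover have "(x, x) \<in> strong H \<and> (y, y) \<in> strong H" if "(x, y) \<in> nonstrong_part H ?F" for x y
    using that by (auto simp: nonstrong_part_def forced_edges_def)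
  moreover have "bridge H x y" if "(x, y) \<in> ?F" for x y
    using acyclic_bridge[OF H ac forced_edges_adjacent[OF that]] .
  ultimately show ?thesis
    unfolding matching_property_def using sep by blast
qed

text \<open>Since \<open>x\<close> has at most one neighbour in \<open>K\<close>, the ordering has
  length at most one and each domination condition compares a vertex with itself or with
  \<open>x\<close>.\<close>

lemma acyclic_domination_property:
  assumes H: "trigraph H" and ac: "\<nexists>vs. cycle H vs"
    and x: "(x, x) \<in> strong H" and K: "K \<in> components (delete_vertex (delete_edges H (forced_edges H)) x)"
  shows "domination_property (delete_edges H (forced_edges H)) x K"
proof -
  let ?H' = "delete_edges H (forced_edges H)"
  have H': "trigraph ?H'" by (rule trigraph_delete_edges[OF H])
  have uniq: "y = z" if "y \<in> K" "z \<in> K" "adjacent ?H' x y" "adjacent ?H' x z" for y z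
  proof -
    let ?r = "adjacent (delete_vertex ?H' x)"
    obtain u where "K = component_of (delete_vertex ?H' x) u"
      using K unfolding components_def by blast
    with that have "?r\<^sup>*\<^sup>* u y" "?r\<^sup>*\<^sup>* u z"
      by (simp_all add: component_of_def)
    moreover have "symp ?r" by (auto intro: sympI adjacent_sym)
    ultimately have "?r\<^sup>*\<^sup>* y z"
      by (meson rtranclp_trans sympD symp_rtranclp)
    \<comment> \<open>Reachability is carried over to \<open>H\<close>, the trigraph assumed
      acyclic.\<close>
    then have "(adjacent (delete_vertex H x))\<^sup>*\<^sup>* y z"
      by (rule rtranclp_mono[THEN predicate2D, rotated])
        (auto simp: adjacent_delete_vertex[OF H] adjacent_delete_vertex[OF H'] adjacent_delete_edges)
    with that show ?thesis
      by (meson acyclic_unique_neighbour[OF H ac] adjacent_delete_edges)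
  qed
  define R where "R = {y \<in> K. symmetric_edge ?H' x y}"
  have R_uniq: "y = z" if "y \<in> R" "z \<in> K" "adjacent ?H' x z" for y z
    using that uniq by (auto simp: R_def dest: symmetric_edge_adjacent)
  \<comment> \<open>A symmetric edge between two strong loops is forced in \<open>H\<close>, so it
    cannot survive in \<open>?H'\<close>.\<close>
  have D1: "(y, y) \<notin> strong ?H'" if "y \<in> R" for y
    using that x by (auto simp: R_def symmetric_edge_def delete_edges_def edges_def forced_edges_def)
  have ordering: "\<exists>xs. distinct xs \<and> set xs = {y \<in> R. (y, y) \<in> weak ?H'} \<and> domination_ordering ?H' xs"
  proof -
    have R_eq: "y = z" if "y \<in> R" "z \<in> R" for y z
      using R_uniq[OF that(1), of z] that(2) by (simp add: R_def symmetric_edge_adjacent)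
    consider "{y \<in> R. (y, y) \<in> weak ?H'} = {}" | v where "{y \<in> R. (y, y) \<in> weak ?H'} = {v}"
      using R_eq by blast
    then show ?thesis
    proof cases
      case 1
      then show ?thesis by (intro exI[of _ "[]"]) (auto simp: domination_ordering_def)
    next
      case (2 v)
      then show ?thesis by (intro exI[of _ "[v]"]) (auto simp: domination_ordering_def)
    qed
  qed
  have dom_x: "weakly_dominates_on ?H' K y x" if y: "y \<in> R" "(y, y) \<in> weak ?H'" for y
  proof -
    \<comment> \<open>Any \<open>z\<close> in \<open>K\<close> joined to \<open>x\<close> is thus a
      true neighbour and equals \<open>y\<close>; domination then asks only for the weak loop at
      \<open>y\<close>.\<close>
    have "x \<notin> K"
      using K by (auto simp: components_def component_of_def delete_vertex_def Let_def)
    then have "z = y" if "z \<in> K" "(z, x) \<in> weak ?H' \<or> (x, z) \<in> weak ?H'" for z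
      using R_uniq[OF y(1) that(1)] that by (auto simp: adjacent_def edges_def)
    with y(2) show ?thesis by (auto simp: weakly_dominates_on_def)
  qed
  have dom_loopless: "weakly_dominates ?H' y z"
    if "y \<in> R" "(y, y) \<in> weak ?H'" "z \<in> R" "(z, z) \<notin> edges ?H'" for y z
  proof -
    \<comment> \<open>Here \<open>z\<close> would be loopless and yet equal to \<open>y\<close>,
      which has a weak loop.\<close>
    have "y = z" using R_uniq that by (auto simp: R_def dest: symmetric_edge_adjacent)
    with that show ?thesis by (simp add: edges_def)
  qed
  show ?thesis
    unfolding domination_property_def Let_def R_def[symmetric]
    using D1 ordering dom_x dom_loopless by simp
qed

lemma trees_subset_special: "trigraph_trees \<subseteq> special_trigraphs"
proof
  fix H :: "'a trigraph"
  assume "H \<in> trigraph_trees"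
  then have H: "trigraph H" and ac: "\<nexists>vs. cycle H vs"
    by (auto simp: trigraph_trees_def)
  have "domination_property (delete_edges H (forced_edges H)) x K"
    if "(x, x) \<in> strong (delete_edges H (forced_edges H))"
      "K \<in> components (delete_vertex (delete_edges H (forced_edges H)) x)" for x K
    using acyclic_domination_property[OF H ac _ that(2)] that(1) by (simp add: delete_edges_def)
  then show "H \<in> special_trigraphs"
    using H acyclic_matching_property_forced_edges[OF H ac]
    by (auto simp: special_trigraphs_def forced_edges_def intro!: exI[of _ "forced_edges H"])
qed

section \<open>Special trigraphs are tree-like: removing strong loops one by one\<close>

text \<open>Deleting \<open>v\<close> only removes pairs ending at \<open>v\<close>, so surviving
  vertices keep their loops and their dominations, and no new symmetric neighbours arise.\<close>

lemma domination_property_delete_vertex: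
  assumes dom: "domination_property H x K" and K': "K' \<subseteq> K - {v}" "K \<subseteq> verts H"
  shows "domination_property (delete_vertex H v) x K'"
proof -
  let ?H' = "delete_vertex H v"
  define R where "R = {y \<in> K. symmetric_edge H x y}"
  define R' where "R' = {y \<in> K'. symmetric_edge ?H' x y}"
  have R': "R' \<subseteq> R"
    using K' by (auto simp: R_def R'_def symmetric_edge_def edges_def delete_vertex_def Let_def)
  have verts: "y \<in> verts ?H'" if "y \<in> K'" for y
    using that K' by (auto simp: delete_vertex_def Let_def)
  have loop: "(y, y) \<in> weak ?H' \<longleftrightarrow> (y, y) \<in> weak H" "(y, y) \<in> strong ?H' \<longleftrightarrow> (y, y) \<in> strong H"
    if "y \<in> K'" for y
    using verts[OF that] by (auto simp: delete_vertex_def Let_def)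
  \<comment> \<open>Only the dominating vertex \<open>y\<close> must survive: the pairs to be
    matched are edges of \<open>?H'\<close>, so their ends survive anyway.\<close>
  have wd: "weakly_dominates_on ?H' D' y z"
    if "weakly_dominates_on H D y z" "y \<in> K'" "D' \<subseteq> D" for y z D D'
    using that verts[OF that(2)] by (auto simp: weakly_dominates_on_def delete_vertex_def Let_def)
  have wd_all: "weakly_dominates ?H' y z" if "weakly_dominates H y z" "y \<in> K'" for y z
    using wd[OF that] by (simp add: delete_vertex_def Let_def)
  have D: "\<forall>y \<in> R. (y, y) \<notin> strong H"
    "\<forall>y \<in> {y \<in> R. (y, y) \<in> weak H}. weakly_dominates_on H K y x"
    "\<forall>y \<in> {y \<in> R. (y, y) \<in> weak H}. \<forall>z \<in> R. (z, z) \<notin> edges H \<longrightarrow> weakly_dominates H y z"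
    and "\<exists>xs. distinct xs \<and> set xs = {y \<in> R. (y, y) \<in> weak H} \<and> domination_ordering H xs"
    using dom unfolding domination_property_def Let_def R_def[symmetric] by blast+
  then obtain xs where xs: "distinct xs" "set xs = {y \<in> R. (y, y) \<in> weak H}" "domination_ordering H xs"
    by blast
  \<comment> \<open>A sublist of a domination ordering is again one.\<close>
  let ?ys = "filter (\<lambda>y. y \<in> R') xs"
  have R'K': "R' \<subseteq> K'" by (auto simp: R'_def)
  have ys: "set ?ys = {y \<in> R'. (y, y) \<in> weak ?H'}"
    using xs R' R'K' loop by auto
  have "sorted_wrt (weakly_dominates H) ?ys"
    using xs(3) by (simp add: domination_ordering_def sorted_wrt_filter)
  then have "domination_ordering ?H' ?ys"
    unfolding domination_ordering_def
    by (rule sorted_wrt_mono_rel[rotated]) (use R'K' wd_all in auto)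
  with ys xs(1)
  have ordering: "\<exists>xs. distinct xs \<and> set xs = {y \<in> R'. (y, y) \<in> weak ?H'} \<and> domination_ordering ?H' xs"
    by (intro exI[of _ ?ys]) auto
  have D1: "\<forall>y \<in> R'. (y, y) \<notin> strong ?H'"
    using D(1) R' R'K' loop by blast
  have D2: "\<forall>y \<in> {y \<in> R'. (y, y) \<in> weak ?H'}. weakly_dominates_on ?H' K' y x"
    using D(2) R' R'K' loop wd[where D = K and D' = K'] K' by blast
  have D3: "\<forall>y \<in> {y \<in> R'. (y, y) \<in> weak ?H'}. \<forall>z \<in> R'. (z, z) \<notin> edges ?H' \<longrightarrow> weakly_dominates ?H' y z"
  proof (intro ballI impI)
    fix y z
    assume y: "y \<in> {y \<in> R'. (y, y) \<in> weak ?H'}" and z: "z \<in> R'" "(z, z) \<notin> edges ?H'"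
    then have "y \<in> {y \<in> R. (y, y) \<in> weak H}" "z \<in> R" "(z, z) \<notin> edges H" "y \<in> K'"
      using R' R'K' loop by (auto simp: edges_def)
    with D(3) show "weakly_dominates ?H' y z" by (blast intro: wd_all)
  qed
  show ?thesis
    unfolding domination_property_def Let_def R'_def[symmetric]
    using D1 ordering D2 D3 by blast
qed

text \<open>Paths that avoid both \<open>v\<close> and \<open>x\<close> also avoid \<open>x\<close>,
  so deleting \<open>v\<close> can only shrink or split components; \<open>K\<close> is the
  component of the same base vertex.\<close>

lemma component_delete_vertex_subset:
  assumes H: "trigraph H" and K': "K' \<in> components (delete_vertex (delete_vertex H v) x)"
  obtains K where "K \<in> components (delete_vertex H x)" "K' \<subseteq> K - {v}" "K \<subseteq> verts H"
proof -
  let ?r = "adjacent (delete_vertex H x)" and ?s = "adjacent (delete_vertex (delete_vertex H v) x)"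
  obtain u where u: "u \<in> verts (delete_vertex (delete_vertex H v) x)"
    "K' = component_of (delete_vertex (delete_vertex H v) x) u"
    using K' by (auto simp: components_def)
  have "?s \<le> ?r"
    by (auto simp: adjacent_delete_vertex[OF trigraph_delete_vertex[OF H]] adjacent_delete_vertex[OF H])
  then have mono: "?s\<^sup>*\<^sup>* a b \<Longrightarrow> ?r\<^sup>*\<^sup>* a b" for a b
    by (metis predicate2D rtranclp_mono)
  show ?thesis
  proof
    show "component_of (delete_vertex H x) u \<in> components (delete_vertex H x)"
      using u(1) by (auto simp: components_def delete_vertex_def Let_def)
    show "K' \<subseteq> component_of (delete_vertex H x) u - {v}"
      using mono by (auto simp: u(2) component_of_def delete_vertex_def[of _ x] delete_vertex_def[of _ v] Let_def)
    show "component_of (delete_vertex H x) u \<subseteq> verts H"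
      by (auto simp: component_of_def delete_vertex_def Let_def)
  qed
qed

text \<open>Induction on the number of vertices: a vertex with a strong loop is deleted, and the
  domination property of the other strong loops is inherited, until no strong edge is left.\<close>

lemma tree_like_if_all_strong_edges_loops:
  assumes "trigraph H" "strong H \<subseteq> Id"
    and "\<And>x K. (x, x) \<in> strong H \<Longrightarrow> K \<in> components (delete_vertex H x) \<Longrightarrow> domination_property H x K"
  shows "H \<in> tree_like_trigraphs"
  using assms
proof (induction "card (verts H)" arbitrary: H rule: less_induct)
  case less
  show ?case
  proof (cases "strong H = {}")
    case True
    with less.prems(1) show ?thesis by (rule no_strong)
  next
    case False
    with less.prems(2) obtain v where v: "(v, v) \<in> strong H" by auto
    let ?H' = "delete_vertex H v"
    have "v \<in> verts H" "finite (verts H)"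
      using v less.prems(1) by (auto simp: trigraph_def)
    then have "card (verts ?H') < card (verts H)"
      by (simp only: delete_vertex_def Let_def trigraph.simps card_Diff1_less)
    moreover have "strong ?H' \<subseteq> strong H"
      by (auto simp: delete_vertex_def Let_def)
    moreover have "domination_property ?H' x K"
      if x: "(x, x) \<in> strong ?H'" and K: "K \<in> components (delete_vertex ?H' x)" for x K
    proof -
      from less.prems(1) K obtain L
        where "L \<in> components (delete_vertex H x)" "K \<subseteq> L - {v}" "L \<subseteq> verts H"
        by (rule component_delete_vertex_subset)
      with x \<open>strong ?H' \<subseteq> strong H\<close> less.prems(3) show ?thesis
        by (blast intro: domination_property_delete_vertex)
    qed
    ultimately have "?H' \<in> tree_like_trigraphs"
      using less.prems(2) by (intro less.hyps trigraph_delete_vertex[OF less.prems(1)]) auto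
    then show ?thesis
      using less.prems(1,3) v by (blast intro: delete_strong_loop)
  qed
qed

lemma special_subset_tree_like: "special_trigraphs \<subseteq> tree_like_trigraphs"
proof
  fix H :: "'a trigraph"
  assume "H \<in> special_trigraphs"
  then obtain F where H: "trigraph H" and F: "forced_edges H \<subseteq> F" "F \<subseteq> edges H" "matching_property H F"
    and dom: "\<And>x K. (x, x) \<in> strong (delete_edges H F) \<Longrightarrow>
      K \<in> components (delete_vertex (delete_edges H F) x) \<Longrightarrow> domination_property (delete_edges H F) x K"
    by (auto simp: special_trigraphs_def)
  \<comment> \<open>Strong edges between distinct vertices are forced, hence lie in
    \<open>F\<close>.\<close>
  have "strong (delete_edges H F) \<subseteq> Id"
    using F(1) by (auto simp: delete_edges_def forced_edges_def edges_def)
  then have "delete_edges H F \<in> tree_like_trigraphs"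
    using trigraph_delete_edges[OF H] dom by (intro tree_like_if_all_strong_edges_loops)
  with H F show "H \<in> tree_like_trigraphs" by (blast intro: delete_matching)
qed

theorem theorem4:
  shows "(trigraph_trees :: 'a trigraph set) \<subseteq> special_trigraphs \<and>
         (special_trigraphs :: 'a trigraph set) \<subseteq> tree_like_trigraphs"
  using trees_subset_special special_subset_tree_like by blast

end
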